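(* Let $\mu$ be a measure on $\mathbb{R}$ with compact support, let $E=\sigma_{\mathrm{ess}}(\mu)$ and suppose $C(E)>0$. Suppose the equilibrium measure $\rho_E$ is absolutely continuous with respect to $\mu$ (equivalently, $d\mu=w\,d\rho_E+d\mu_s$ with $\mu_s$ singular with respect to $\rho_E$ and $w(x)>0$ for $\rho_E$-a.e. $x$). Then $\mu$ is regular. *)

theory Defs
  imports "HOL-Analysis.Analysis" "HOL-Computational_Algebra.Polynomial"
begin

definition msupp :: "real measure \<Rightarrow> real set" where
  "msupp \<mu> = {x. \<forall>e>0. emeasure \<mu> (ball x e) \<noteq> 0}"

definition ess_supp :: "real measure \<Rightarrow> real set" where
  "ess_supp \<mu> = {x \<in> msupp \<mu>. x islimpt msupp \<mu>}"

definition prob_on :: "real set \<Rightarrow> real measure set" where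
  "prob_on E = {\<nu>. sets \<nu> = sets borel \<and> emeasure \<nu> UNIV = 1 \<and> emeasure \<nu> (UNIV - E) = 0}"

definition logk_pos :: "real \<Rightarrow> real \<Rightarrow> ennreal" where
  "logk_pos x y = (if x = y then \<infinity> else ennreal (max 0 (- ln \<bar>x - y\<bar>)))"

definition logk_neg :: "real \<Rightarrow> real \<Rightarrow> ennreal" where
  "logk_neg x y = (if x = y then 0 else ennreal (max 0 (ln \<bar>x - y\<bar>)))"

definition log_energy :: "real measure \<Rightarrow> ereal" where
  "log_energy \<nu> =
     enn2ereal (\<integral>\<^sup>+ x. \<integral>\<^sup>+ y. logk_pos x y \<partial>\<nu> \<partial>\<nu>)
   - enn2ereal (\<integral>\<^sup>+ x. \<integral>\<^sup>+ y. logk_neg x y \<partial>\<nu> \<partial>\<nu>)"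

definition robin_const :: "real set \<Rightarrow> ereal" where
  "robin_const E = (INF \<nu>\<in>prob_on E. log_energy \<nu>)"

definition log_capacity :: "real set \<Rightarrow> real" where
  "log_capacity E = (if robin_const E = \<infinity> then 0 else exp (- real_of_ereal (robin_const E)))"

definition equilibrium_measure :: "real set \<Rightarrow> real measure \<Rightarrow> bool" where
  "equilibrium_measure E \<rho> \<longleftrightarrow> \<rho> \<in> prob_on E \<and> log_energy \<rho> = robin_const E"

text \<open>L^2(mu) norm of the n-th monic orthogonal polynomial, via its extremal property.\<close>
definition monic_OP_norm :: "real measure \<Rightarrow> nat \<Rightarrow> real" where
  "monic_OP_norm \<mu> n =
     Inf {sqrt (\<integral>x. (poly p x)\<^sup>2 \<partial>\<mu>) | p :: real poly. degree p = n \<and> lead_coeff p = 1}"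

text \<open>Regularity in the sense of Stahl--Totik: ||P_n||^(1/n) tends to C(ess supp).\<close>
definition regular_measure :: "real measure \<Rightarrow> bool" where
  "regular_measure \<mu> \<longleftrightarrow>
     (\<lambda>n. monic_OP_norm \<mu> n powr (1 / real n)) \<longlonglongrightarrow> log_capacity (ess_supp \<mu>)"

end

theory Submission
  imports Defs "HOL-Probability.Probability" "HOL-Computational_Algebra.Fundamental_Theorem_Algebra"
begin

text \<open>
  Write \<open>C\<close> for the capacity of \<open>E\<close> and \<open>U\<close> for the logarithmic potential of the equilibrium
  measure \<open>\<rho>\<close>. Minimality of the energy gives \<open>U \<le> - ln C\<close> on the whole convex hull of \<open>E\<close>.

  Lower bound: a monic polynomial \<open>P\<close> of degree \<open>n\<close> dominates on the hull one with all its zeros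
  there, and integrating \<open>- ln \<bar>P\<bar>\<close> against \<open>\<rho>\<close> yields at most \<open>- n * ln C\<close>. Hence for \<open>B < C\<close> the
  set \<open>{\<bar>P\<bar> > B ^ n}\<close> has \<open>\<rho>\<close>-measure bounded below independently of \<open>n\<close>; by absolute continuity
  so does its \<open>\<mu>\<close>-measure, and \<open>\<parallel>P\<parallel> \<ge> const * B ^ n\<close>.

  Upper bound: for \<open>B > C\<close> some monic \<open>T\<close> satisfies \<open>\<bar>T\<bar> < B ^ degree T\<close> on \<open>E\<close>, since otherwise a
  weak limit of point measures on \<open>E\<close> would have energy below the minimum. Powers of \<open>T\<close>, multiplied
  by a fixed polynomial vanishing at the finitely many points of the support where \<open>T\<close> is not small,
  give \<open>\<parallel>P_n\<parallel> \<le> const * B ^ n\<close>.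
\<close>

section \<open>Logarithmic kernel and energy, shifted by a constant to become nonnegative\<close>

text \<open>
  Here \<open>R\<close> bounds the diameter of the sets involved, which makes the kernel nonnegative. The value
  at \<open>0\<close> is set by hand because \<open>ln 0 = 0\<close>.
\<close>

definition logdist :: "real \<Rightarrow> real \<Rightarrow> ennreal" where
  "logdist R d = (if d = 0 then \<infinity> else ennreal (ln R - ln d))"

definition scaled_energy :: "real \<Rightarrow> real measure \<Rightarrow> ennreal" where
  "scaled_energy R \<nu> = (\<integral>\<^sup>+ x. \<integral>\<^sup>+ y. logdist R \<bar>x - y\<bar> \<partial>\<nu> \<partial>\<nu>)"

definition scaled_potential :: "real \<Rightarrow> real measure \<Rightarrow> real \<Rightarrow> ennreal" where
  "scaled_potential R \<nu> c = (\<integral>\<^sup>+ x. logdist R \<bar>c - x\<bar> \<partial>\<nu>)"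

lemma logdist_0 [simp]: "logdist R 0 = \<infinity>"
  by (simp add: logdist_def)

lemma measurable_logdist [measurable]: "logdist R \<in> borel_measurable borel"
  unfolding logdist_def by measurable

lemma logdist_antimono: "0 \<le> d \<Longrightarrow> d \<le> e \<Longrightarrow> logdist R e \<le> logdist R d"
  by (auto simp: logdist_def intro!: ennreal_leI)

text \<open>Continuity includes the point \<open>0\<close>, where the value is
  \<open>\<infinity>\<close>. Combined with Fatou's lemma it gives lower semicontinuity of
  potentials and energies.\<close>

lemma tendsto_logdist:
  assumes lim: "d \<longlonglongrightarrow> l" and nonneg: "\<And>n. 0 \<le> d n"
  shows "(\<lambda>n. logdist R (d n)) \<longlonglongrightarrow> logdist R l"
proof (cases "l = 0")
  case True
  have "\<forall>\<^sub>F n in sequentially. ennreal k < logdist R (d n)" if "0 \<le> k" for k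
  proof -
    have "\<forall>\<^sub>F n in sequentially. d n < exp (ln R - k)"
      using lim True by (intro order_tendstoD) auto
    then show ?thesis
    proof eventually_elim
      case (elim n)
      show ?case
      proof (cases "d n = 0")
        case False
        then have "0 < d n" using nonneg[of n] by linarith
        then have "ln (d n) < ln R - k"
          using elim by (metis ln_exp ln_less_cancel_iff exp_gt_zero)
        then show ?thesis
          using False that by (simp add: logdist_def ennreal_less_iff)
      qed simp
    qed
  qed
  then show ?thesis
    using True by (simp add: tendsto_top_iff_ennreal)
next
  case False
  have "0 \<le> l" using LIMSEQ_le_const[OF lim] nonneg by blast
  have "\<forall>\<^sub>F n in sequentially. d n \<noteq> 0"
    by (rule tendsto_imp_eventually_ne[OF lim False])
  then have "\<forall>\<^sub>F n in sequentially. ennreal (ln R - ln (d n)) = logdist R (d n)"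
    by eventually_elim (simp add: logdist_def)
  moreover have "(\<lambda>n. ennreal (ln R - ln (d n))) \<longlonglongrightarrow> ennreal (ln R - ln l)"
    using False by (intro tendsto_ennrealI tendsto_intros lim)
  ultimately show ?thesis
    using False by (simp add: logdist_def tendsto_cong)
qed

lemma prob_onD:
  assumes "\<nu> \<in> prob_on E"
  shows "sets \<nu> = sets borel" "space \<nu> = UNIV" "emeasure \<nu> UNIV = 1" "prob_space \<nu>"
    and "E \<in> sets borel \<Longrightarrow> AE x in \<nu>. x \<in> E"
proof -
  show *: "sets \<nu> = sets borel" "emeasure \<nu> UNIV = 1" using assms by (auto simp: prob_on_def)
  show sp: "space \<nu> = UNIV" using sets_eq_imp_space_eq[OF *(1)] by simp
  show "prob_space \<nu>" by (rule prob_spaceI) (simp add: sp *)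
  assume "E \<in> sets borel"
  moreover have "emeasure \<nu> (UNIV - E) = 0" using assms by (simp add: prob_on_def)
  ultimately have "UNIV - E \<in> null_sets \<nu>" using * by (auto simp: null_sets_def)
  then show "AE x in \<nu>. x \<in> E" using AE_not_in by fastforce
qed

text \<open>On a set of diameter at most \<open>R\<close> the logarithmic kernel is
  \<open>logdist R\<close> minus the constant \<open>ln R\<close>, and \<open>\<nu>\<close> has mass
  one. The later arguments can then work with nonnegative integrals only.\<close>

lemma log_energy_eq:
  assumes \<nu>: "\<nu> \<in> prob_on E" and E: "E \<in> sets borel" "E \<subseteq> {a..b}" and R: "b - a \<le> R" "1 \<le> R"
  shows "log_energy \<nu> = enn2ereal (scaled_energy R \<nu>) - ereal (ln R)"
proof -
  interpret prob_space \<nu> using prob_onD[OF \<nu>] by simp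
  note [measurable_cong] = prob_onD(1)[OF \<nu>]
  note AE_E = prob_onD(5)[OF \<nu> E(1)]
  have [measurable]: "(\<lambda>(x, y). logk_pos x y) \<in> borel_measurable (borel \<Otimes>\<^sub>M borel)"
    "(\<lambda>(x, y). logk_neg x y) \<in> borel_measurable (borel \<Otimes>\<^sub>M borel)"
    unfolding logk_pos_def logk_neg_def by measurable
  define N where "N = (\<integral>\<^sup>+ x. \<integral>\<^sup>+ y. logk_neg x y \<partial>\<nu> \<partial>\<nu>)"
  define P where "P = (\<integral>\<^sup>+ x. \<integral>\<^sup>+ y. logk_pos x y \<partial>\<nu> \<partial>\<nu>)"
  have dist: "\<bar>x - y\<bar> \<le> R" if "x \<in> E" "y \<in> E" for x y
    using subsetD[OF E(2) that(1)] subsetD[OF E(2) that(2)] R by (auto simp: abs_le_iff)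
  have neg: "logk_neg x y \<le> ennreal (ln R)" if "x \<in> E" "y \<in> E" for x y
    using dist[OF that] R by (auto simp: logk_neg_def intro!: ennreal_leI)
  \<comment> \<open>Stated with sums, because subtraction in \<open>ennreal\<close> truncates. It
    needs \<open>0 \<le> ln R\<close>, hence \<open>1 \<le> R\<close>.\<close>
  have split: "logdist R \<bar>x - y\<bar> + logk_neg x y = logk_pos x y + ennreal (ln R)"
    if "x \<in> E" "y \<in> E" for x y
  proof (cases "x = y")
    case False
    have "ln \<bar>x - y\<bar> \<le> ln R" using False dist[OF that] by simp
    moreover have "0 \<le> ln R" using R by simp
    ultimately show ?thesis
      using False by (auto simp: logdist_def logk_neg_def logk_pos_def max_def simp flip: ennreal_plus)
  qed (simp add: logk_pos_def logk_neg_def)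
  \<comment> \<open>Finiteness of \<open>N\<close> allows it to be subtracted from both sides at the
    end.\<close>
  have "N \<le> (\<integral>\<^sup>+ x. \<integral>\<^sup>+ y. ennreal (ln R) \<partial>\<nu> \<partial>\<nu>)"
    unfolding N_def
    by (rule nn_integral_mono_AE, use AE_E in eventually_elim)
       (rule nn_integral_mono_AE, use AE_E in eventually_elim, auto intro: neg)
  also have "\<dots> = ennreal (ln R)" by (simp add: emeasure_space_1)
  finally have "N < \<infinity>" by (simp add: le_less_trans)
  have "scaled_energy R \<nu> + N
      = (\<integral>\<^sup>+ x. \<integral>\<^sup>+ y. logdist R \<bar>x - y\<bar> + logk_neg x y \<partial>\<nu> \<partial>\<nu>)"
    by (simp add: scaled_energy_def N_def nn_integral_add)
  also have "\<dots> = (\<integral>\<^sup>+ x. \<integral>\<^sup>+ y. logk_pos x y + ennreal (ln R) \<partial>\<nu> \<partial>\<nu>)"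
    by (rule nn_integral_cong_AE, use AE_E in eventually_elim)
       (rule nn_integral_cong_AE, use AE_E in eventually_elim, auto intro: split)
  also have "\<dots> = P + ennreal (ln R)"
    by (simp add: P_def nn_integral_add emeasure_space_1)
  finally have eq: "scaled_energy R \<nu> + N = P + ennreal (ln R)" .
  have "ln R \<ge> 0" using R by simp
  have "enn2ereal P - enn2ereal N = enn2ereal (scaled_energy R \<nu>) - ereal (ln R)"
    using eq \<open>N < \<infinity>\<close> \<open>ln R \<ge> 0\<close>
    by (cases P; cases N; cases "scaled_energy R \<nu>")
       (auto simp: enn2ereal_ennreal top_ereal_def enn2ereal_top simp flip: ennreal_plus)
  then show ?thesis
    by (simp add: log_energy_def P_def N_def)
qed

section \<open>First variation and the upper bound for the equilibrium potential\<close>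

text \<open>Here \<open>v\<close> is the minimal energy for the shifted kernel, so the Robin
  constant of \<open>E\<close> is \<open>v - ln R\<close> and its capacity is
  \<open>R * exp (- v)\<close>.\<close>

locale equilibrium =
  fixes E :: "real set" and a b R v :: real and \<rho> :: "real measure"
  assumes closed_E: "closed E" and E_sub: "E \<subseteq> {a..b}" and R: "b - a \<le> R" "0 < R"
    and rho: "\<rho> \<in> prob_on E" and v: "0 \<le> v" "scaled_energy R \<rho> = ennreal v"
    and minimal: "\<And>\<nu>. \<nu> \<in> prob_on E \<Longrightarrow> ennreal v \<le> scaled_energy R \<nu>"
begin

sublocale prob_space \<rho>
  using prob_onD(4)[OF rho] .

lemma sets_rho [simp, measurable_cong]: "sets \<rho> = sets borel"
  using prob_onD(1)[OF rho] .

lemma space_rho [simp]: "space \<rho> = UNIV"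
  using prob_onD(2)[OF rho] .

lemma E_borel [measurable]: "E \<in> sets borel"
  using closed_E by simp

lemma AE_rho: "AE x in \<rho>. x \<in> E"
  using prob_onD(5)[OF rho] by simp

abbreviation U :: "real \<Rightarrow> ennreal" where
  "U \<equiv> scaled_potential R \<rho>"

lemma measurable_U [measurable]: "U \<in> borel_measurable borel"
  unfolding scaled_potential_def by measurable

lemma nn_integral_U: "(\<integral>\<^sup>+ x. U x \<partial>\<rho>) = ennreal v"
  using v by (simp add: scaled_energy_def scaled_potential_def)

text \<open>First variation of the energy: moving a little mass of \<open>\<rho>\<close> onto
  \<open>A\<close> cannot lower the energy, so the mean of \<open>U\<close> over \<open>A\<close> is
  at least \<open>v\<close>.\<close>

lemma nn_integral_U_subset:
  assumes A [measurable]: "A \<in> sets borel" and pos: "0 < emeasure \<rho> A"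
  shows "ennreal v * emeasure \<rho> A \<le> (\<integral>\<^sup>+ x. U x * indicator A x \<partial>\<rho>)"
proof -
  define m where "m = measure \<rho> A"
  have m: "0 < m" "emeasure \<rho> A = ennreal m"
    using pos by (auto simp: m_def emeasure_eq_measure)
  let ?K = "\<lambda>x y. logdist R \<bar>x - y\<bar>"
  \<comment> \<open>\<open>p\<close> is the mutual energy of \<open>\<rho>\<close> and its
    restriction to \<open>A\<close>; \<open>q\<close> is the energy of that restriction.\<close>
  define p where "p = (\<integral>\<^sup>+ x. U x * indicator A x \<partial>\<rho>)"
  define q where "q = (\<integral>\<^sup>+ x. (\<integral>\<^sup>+ y. ?K x y * indicator A y \<partial>\<rho>) * indicator A x \<partial>\<rho>)"
  have p_sym: "(\<integral>\<^sup>+ x. \<integral>\<^sup>+ y. ?K x y * indicator A y \<partial>\<rho> \<partial>\<rho>) = p"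
  proof -
    interpret pair_sigma_finite \<rho> \<rho> ..
    have "(\<integral>\<^sup>+ x. \<integral>\<^sup>+ y. ?K x y * indicator A y \<partial>\<rho> \<partial>\<rho>)
        = (\<integral>\<^sup>+ y. \<integral>\<^sup>+ x. ?K x y * indicator A y \<partial>\<rho> \<partial>\<rho>)"
      by (rule Fubini'[symmetric]) simp
    also have "\<dots> = p"
      unfolding p_def scaled_potential_def
      by (simp add: nn_integral_multc abs_minus_commute)
    finally show ?thesis .
  qed
  have "p \<le> (\<integral>\<^sup>+ x. U x \<partial>\<rho>)"
    unfolding p_def by (intro nn_integral_mono) (auto split: split_indicator)
  then have "p < \<infinity>" by (simp add: nn_integral_U le_less_trans)
  have "q \<le> p"
    unfolding q_def p_def scaled_potential_def
    by (intro nn_integral_mono mult_right_mono) (auto split: split_indicator)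
  then have "q < \<infinity>" using \<open>p < \<infinity>\<close> by simp
  obtain p' where p': "p = ennreal p'" "0 \<le> p'" using \<open>p < \<infinity>\<close> by (cases p) auto
  obtain q' where q': "q = ennreal q'" "0 \<le> q'" using \<open>q < \<infinity>\<close> by (cases q) auto
  \<comment> \<open>The competitor is \<open>1 - t\<close> times \<open>\<rho>\<close> plus
    \<open>t\<close> times the normalized restriction of \<open>\<rho>\<close> to \<open>A\<close>;
    its energy is quadratic in \<open>t\<close>.\<close>
  have main: "v \<le> (1 - t)\<^sup>2 * v + 2 * ((1 - t) * (t / m)) * p' + (t / m)\<^sup>2 * q'"
    if t: "0 < t" "t < 1" for t
  proof -
    define \<alpha> where "\<alpha> = ennreal (1 - t)"
    define \<beta> where "\<beta> = ennreal (t / m)"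
    define h where "h x = \<alpha> + \<beta> * indicator A x" for x :: real
    have [measurable]: "h \<in> borel_measurable borel" unfolding h_def by measurable
    define \<nu> where "\<nu> = density \<rho> h"
    have "emeasure \<nu> UNIV = (\<integral>\<^sup>+ x. \<alpha> + \<beta> * indicator A x \<partial>\<rho>)"
      by (simp add: \<nu>_def emeasure_density h_def)
    also have "\<dots> = \<alpha> + \<beta> * ennreal m"
      by (simp add: nn_integral_add nn_integral_cmult emeasure_space_1[simplified] m(2))
    also have "\<dots> = 1"
      using t m(1) by (simp add: \<alpha>_def \<beta>_def flip: ennreal_mult ennreal_plus)
    finally have "emeasure \<nu> UNIV = 1" .
    moreover have "emeasure \<nu> (UNIV - E) = 0"
    proof -
      have "UNIV - E \<in> null_sets \<rho>"
        using rho by (auto simp: prob_on_def null_sets_def)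
      then have "emeasure \<rho> (UNIV - E) = 0" by auto
      then show ?thesis
        unfolding \<nu>_def by (intro absolutely_continuousD[OF absolutely_continuousI_density]) auto
    qed
    ultimately have "\<nu> \<in> prob_on E" by (simp add: prob_on_def \<nu>_def)
    then have "ennreal v \<le> scaled_energy R \<nu>" by (rule minimal)
    also have "\<dots> = (\<integral>\<^sup>+ x. h x * (\<integral>\<^sup>+ y. h y * ?K x y \<partial>\<rho>) \<partial>\<rho>)"
      unfolding scaled_energy_def \<nu>_def by (simp add: nn_integral_density)
    also have "\<dots> = (\<integral>\<^sup>+ x. h x * (\<alpha> * U x + \<beta> * (\<integral>\<^sup>+ y. ?K x y * indicator A y \<partial>\<rho>)) \<partial>\<rho>)"
      unfolding h_def scaled_potential_def
      by (simp add: distrib_right nn_integral_add nn_integral_cmult mult.assoc mult.commute[of "indicator A _" ])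
    also have "\<dots> = (\<integral>\<^sup>+ x. \<alpha> * \<alpha> * U x + \<alpha> * \<beta> * (\<integral>\<^sup>+ y. ?K x y * indicator A y \<partial>\<rho>)
         + \<alpha> * \<beta> * (U x * indicator A x)
         + \<beta> * \<beta> * ((\<integral>\<^sup>+ y. ?K x y * indicator A y \<partial>\<rho>) * indicator A x) \<partial>\<rho>)"
      unfolding h_def by (intro nn_integral_cong) (simp add: distrib_left distrib_right ac_simps)
    also have "\<dots> = \<alpha> * \<alpha> * ennreal v + \<alpha> * \<beta> * p + \<alpha> * \<beta> * p + \<beta> * \<beta> * q"
      by (simp add: nn_integral_add nn_integral_cmult p_sym nn_integral_U q_def)
         (simp add: p_def)
    also have "\<dots> = ennreal ((1 - t)\<^sup>2 * v + 2 * ((1 - t) * (t / m)) * p' + (t / m)\<^sup>2 * q')"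
      using t m(1) p'(2) q'(2) v(1)
      by (simp add: \<alpha>_def \<beta>_def p'(1) q'(1) power2_eq_square flip: ennreal_mult ennreal_plus)
    finally show ?thesis
      using t m(1) p'(2) q'(2) v(1) by (subst (asm) ennreal_le_iff) (auto intro!: add_nonneg_nonneg)
  qed
  \<comment> \<open>This expression is the inequality \<open>main\<close> after subtracting
    \<open>v\<close> and dividing by \<open>t\<close>. Letting \<open>t\<close> tend to
    \<open>0\<close> leaves the linear coefficient.\<close>
  have lim: "((\<lambda>t. - 2 * v + t * v + 2 * (1 - t) / m * p' + t / m\<^sup>2 * q') \<longlongrightarrow>
      - 2 * v + 0 * v + 2 * (1 - 0) / m * p' + 0 / m\<^sup>2 * q') (at_right 0)"
    using m by (intro tendsto_intros) auto
  have "\<forall>\<^sub>F t in at_right (0::real). 0 \<le> - 2 * v + t * v + 2 * (1 - t) / m * p' + t / m\<^sup>2 * q'"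
    using eventually_at_right_real[OF zero_less_one]
  proof eventually_elim
    case (elim t)
    then have "0 \<le> t * (- 2 * v + t * v + 2 * (1 - t) / m * p' + t / m\<^sup>2 * q')"
      using main[of t] by (simp add: power2_eq_square algebra_simps)
    then show ?case using elim by (simp add: zero_le_mult_iff)
  qed
  from tendsto_lowerbound[OF lim this] have "v * m \<le> p'"
    using m by (simp add: field_simps)
  then show ?thesis
    using v m by (simp add: p'(1) p_def[symmetric] ennreal_leI flip: ennreal_mult)
qed

end

text \<open>For \<open>x\<close> outside the open interval from \<open>\<alpha>\<close> to
  \<open>\<beta>\<close>, the distance to \<open>x\<close> is affine on that interval, and
  \<open>- ln\<close> is convex. The number \<open>t\<close> is the weight of
  \<open>\<alpha>\<close> when \<open>c\<close> is written as a convex combination.\<close>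

lemma logdist_convex:
  assumes le: "\<bar>x - \<alpha>\<bar> \<le> R" "\<bar>x - \<beta>\<bar> \<le> R" and c: "\<alpha> < c" "c < \<beta>" and x: "x \<le> \<alpha> \<or> \<beta> \<le> x"
    and lam: "t = (\<beta> - c) / (\<beta> - \<alpha>)"
  shows "logdist R \<bar>c - x\<bar> \<le> ennreal t * logdist R \<bar>\<alpha> - x\<bar> + ennreal (1 - t) * logdist R \<bar>\<beta> - x\<bar>"
proof -
  have l: "0 < t" "t < 1" using c by (auto simp: lam)
  \<comment> \<open>Concavity of \<open>ln\<close> is applied to positive distances; if
    \<open>x\<close> is an endpoint, the right-hand side is infinite because both weights are
    positive.\<close>
  consider "x = \<alpha>" | "x = \<beta>" | "x \<noteq> \<alpha>" "x \<noteq> \<beta>" by blast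
  then show ?thesis
  proof cases
    case 3
    have nz: "0 < \<bar>\<alpha> - x\<bar>" "0 < \<bar>\<beta> - x\<bar>" "\<bar>c - x\<bar> \<noteq> 0" using 3 x c by auto
    have "t * (\<beta> - \<alpha>) = \<beta> - c" using c by (simp add: lam)
    then have "t * \<bar>\<alpha> - x\<bar> + (1 - t) * \<bar>\<beta> - x\<bar> = \<bar>c - x\<bar>"
      using x c by (auto simp: abs_real_def algebra_simps)
    moreover have "t * ln \<bar>\<alpha> - x\<bar> + (1 - t) * ln \<bar>\<beta> - x\<bar>
        \<le> ln (t * \<bar>\<alpha> - x\<bar> + (1 - t) * \<bar>\<beta> - x\<bar>)"
      using concave_onD[OF ln_concave, of "1 - t" "\<bar>\<alpha> - x\<bar>" "\<bar>\<beta> - x\<bar>"] nz l by simp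
    ultimately have "ln R - ln \<bar>c - x\<bar>
        \<le> t * (ln R - ln \<bar>\<alpha> - x\<bar>) + (1 - t) * (ln R - ln \<bar>\<beta> - x\<bar>)"
      by (simp add: algebra_simps)
    moreover have "0 \<le> ln R - ln \<bar>\<alpha> - x\<bar>" "0 \<le> ln R - ln \<bar>\<beta> - x\<bar>"
      using le nz by (auto simp: abs_minus_commute)
    ultimately show ?thesis
      using nz l 3 by (auto simp: logdist_def ennreal_leI simp flip: ennreal_mult ennreal_plus)
  qed (use l in \<open>auto simp: ennreal_mult_top\<close>)
qed

context equilibrium
begin

text \<open>On \<open>A\<close> the first variation bounds the integral of \<open>U\<close> below by
  \<open>v\<close> times the mass, and off \<open>A\<close> the potential exceeds \<open>v\<close>.
  Since the total integral is only \<open>v\<close>, the excess \<open>W\<close> vanishes.\<close>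

lemma AE_U_le: "AE x in \<rho>. U x \<le> ennreal v"
proof -
  define A where "A = {x. U x \<le> ennreal v}"
  have A [measurable]: "A \<in> sets borel" unfolding A_def by measurable
  define W where "W = (\<integral>\<^sup>+ x. (U x - ennreal v) * indicator (- A) x \<partial>\<rho>)"
  have "ennreal v * emeasure \<rho> A + ennreal v * emeasure \<rho> (- A) = ennreal v * emeasure \<rho> (A \<union> - A)"
    by (subst plus_emeasure[symmetric]) (auto simp: distrib_left)
  also have "\<dots> = ennreal v" using emeasure_space_1 by simp
  finally have total: "ennreal v * emeasure \<rho> A + ennreal v * emeasure \<rho> (- A) = ennreal v" .
  have "ennreal v = (\<integral>\<^sup>+ x. U x \<partial>\<rho>)" by (simp add: nn_integral_U)
  also have "\<dots> = (\<integral>\<^sup>+ x. U x * indicator A x + ennreal v * indicator (- A) x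
      + (U x - ennreal v) * indicator (- A) x \<partial>\<rho>)"
    by (intro nn_integral_cong)
       (auto simp: A_def not_le less_imp_le add_diff_inverse_ennreal split: split_indicator)
  also have "\<dots> = (\<integral>\<^sup>+ x. U x * indicator A x \<partial>\<rho>) + ennreal v * emeasure \<rho> (- A) + W"
    by (simp add: nn_integral_add nn_integral_cmult W_def)
  finally have eq: "ennreal v = \<dots>" .
  have "ennreal v * emeasure \<rho> A \<le> (\<integral>\<^sup>+ x. U x * indicator A x \<partial>\<rho>)"
    using nn_integral_U_subset[OF A] by (cases "emeasure \<rho> A = 0") (auto simp: zero_less_iff_neq_zero)
  then have "ennreal v + W \<le> ennreal v"
    by (subst eq, subst (1) total[symmetric]) (intro add_mono order_refl)
  then have "W = 0"
    by (metis add.right_neutral antisym ennreal_add_left_cancel ennreal_neq_top infinity_ennreal_def le_iff_add zero_le)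
  then have "AE x in \<rho>. (U x - ennreal v) * indicator (- A) x = 0"
    unfolding W_def by (subst (asm) nn_integral_0_iff_AE) auto
  then show ?thesis
    by eventually_elim (auto simp: A_def diff_eq_0_iff_ennreal split: split_indicator_asm)
qed

text \<open>Lower semicontinuity of the potential, from Fatou's lemma along a convergent
  sequence.\<close>

lemma closed_U_le: "closed {c. U c \<le> ennreal v}"
  unfolding closed_sequential_limits
proof safe
  fix c l assume c: "\<forall>n. c n \<in> {c. U c \<le> ennreal v}" and lim: "c \<longlonglongrightarrow> l"
  have "U l = (\<integral>\<^sup>+ x. liminf (\<lambda>n. logdist R \<bar>c n - x\<bar>) \<partial>\<rho>)"
    unfolding scaled_potential_def
    by (intro nn_integral_cong lim_imp_Liminf[symmetric] tendsto_logdist tendsto_intros lim) auto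
  also have "\<dots> \<le> liminf (\<lambda>n. U (c n))"
    unfolding scaled_potential_def by (rule nn_integral_liminf) simp
  also have "\<dots> \<le> ennreal v"
    using c by (intro Liminf_le) auto
  finally show "U l \<le> ennreal v" .
qed

text \<open>
  The potential is at most \<open>v\<close> on a closed set of full measure, and it is convex on the gaps of
  that set because \<open>- ln\<close> is convex.
\<close>
lemma U_le:
  assumes c: "c \<in> {a..b}"
  shows "U c \<le> ennreal v"
proof (cases "U c \<le> ennreal v")
  case False
  \<comment> \<open>Intersecting with \<open>E\<close> keeps all distances within \<open>R\<close>,
    as \<open>logdist_convex\<close> requires.\<close>
  define F where "F = {c. U c \<le> ennreal v} \<inter> E"
  have closed: "closed F" unfolding F_def by (intro closed_Int closed_U_le closed_E)
  have sub: "F \<subseteq> {a..b}" using E_sub by (auto simp: F_def)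
  have "c \<notin> F" using False by (auto simp: F_def)
  have AE_F: "AE x in \<rho>. x \<in> F"
    using AE_U_le AE_rho by eventually_elim (simp add: F_def)
  have U_F: "U x \<le> ennreal v" if "x \<in> F" for x using that by (simp add: F_def)
  have below: "Sup (F \<inter> {..c}) \<in> F \<inter> {..c}" if "F \<inter> {..c} \<noteq> {}"
    using that closed by (intro closed_contains_Sup closed_Int bdd_aboveI[of _ c]) auto
  have above: "Inf (F \<inter> {c..}) \<in> F \<inter> {c..}" if "F \<inter> {c..} \<noteq> {}"
    using that closed by (intro closed_contains_Inf closed_Int bdd_belowI[of _ c]) auto
  have le_below: "x \<le> Sup (F \<inter> {..c})" if "x \<in> F" "x \<le> c" for x
    using that by (intro cSup_upper bdd_aboveI[of _ c]) auto
  have le_above: "Inf (F \<inter> {c..}) \<le> x" if "x \<in> F" "c \<le> x" for x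
    using that by (intro cInf_lower bdd_belowI[of _ c]) auto
  have comparison: "U c \<le> U d" if "AE x in \<rho>. \<bar>d - x\<bar> \<le> \<bar>c - x\<bar>" for d
    unfolding scaled_potential_def
    by (rule nn_integral_mono_AE, use that in eventually_elim) (auto intro: logdist_antimono)
  \<comment> \<open>If \<open>F\<close> lies on one side of \<open>c\<close>, moving
    \<open>c\<close> to the nearest point of \<open>F\<close> shrinks almost all distances and so
    can only raise the potential. Convexity is used only when \<open>c\<close> lies in a gap. An
    empty \<open>F\<close> contradicts its full measure.\<close>
  consider "F \<inter> {..c} = {}" "F \<inter> {c..} = {}" | "F \<inter> {..c} = {}" "F \<inter> {c..} \<noteq> {}"
    | "F \<inter> {..c} \<noteq> {}" "F \<inter> {c..} = {}" | "F \<inter> {..c} \<noteq> {}" "F \<inter> {c..} \<noteq> {}" by blast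
  then show ?thesis
  proof cases
    case 1
    then have "x \<notin> F" for x using linear[of x c] by auto
    then have "AE x in \<rho>. False" using AE_F by simp
    then show ?thesis using ae_filter_bot by (metis trivial_limit_def)
  next
    case 2
    let ?\<beta> = "Inf (F \<inter> {c..})"
    have "AE x in \<rho>. \<bar>?\<beta> - x\<bar> \<le> \<bar>c - x\<bar>"
      using AE_F
    proof eventually_elim
      case (elim x)
      then have "x \<notin> {..c}" using 2(1) by blast
      then show ?case using le_above[of x] above[OF 2(2)] elim by auto
    qed
    then have "U c \<le> U ?\<beta>" by (rule comparison)
    also have "\<dots> \<le> ennreal v" using above[OF 2(2)] by (intro U_F) blast
    finally show ?thesis .
  next
    case 3
    let ?\<alpha> = "Sup (F \<inter> {..c})"
    have "AE x in \<rho>. \<bar>?\<alpha> - x\<bar> \<le> \<bar>c - x\<bar>"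
      using AE_F
    proof eventually_elim
      case (elim x)
      then have "x \<notin> {c..}" using 3(2) by blast
      then show ?case using le_below[of x] below[OF 3(1)] elim by auto
    qed
    then have "U c \<le> U ?\<alpha>" by (rule comparison)
    also have "\<dots> \<le> ennreal v" using below[OF 3(1)] by (intro U_F) blast
    finally show ?thesis .
  next
    case 4
    define \<alpha> \<beta> where "\<alpha> = Sup (F \<inter> {..c})" and "\<beta> = Inf (F \<inter> {c..})"
    have \<alpha>: "\<alpha> \<in> F" "\<alpha> < c" using below[OF 4(1)] \<open>c \<notin> F\<close> by (auto simp: \<alpha>_def order_less_le)
    have \<beta>: "\<beta> \<in> F" "c < \<beta>" using above[OF 4(2)] \<open>c \<notin> F\<close> by (auto simp: \<beta>_def order_less_le)
    define t where "t = (\<beta> - c) / (\<beta> - \<alpha>)"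
    have l: "0 < t" "t < 1" using \<alpha> \<beta> by (auto simp: t_def)
    have "U c \<le> (\<integral>\<^sup>+ x. ennreal t * logdist R \<bar>\<alpha> - x\<bar> + ennreal (1 - t) * logdist R \<bar>\<beta> - x\<bar> \<partial>\<rho>)"
      unfolding scaled_potential_def
    proof (rule nn_integral_mono_AE, use AE_F in eventually_elim)
      case (elim x)
      have "a \<le> x" "x \<le> b" "a \<le> \<alpha>" "\<alpha> \<le> b" "a \<le> \<beta>" "\<beta> \<le> b"
        using sub elim \<alpha>(1) \<beta>(1) by (auto dest: subsetD)
      moreover have "x \<le> \<alpha> \<or> \<beta> \<le> x"
        using le_below[of x] le_above[of x] elim unfolding \<alpha>_def \<beta>_def by linarith
      ultimately show ?case
        using R \<alpha>(2) \<beta>(2) by (intro logdist_convex) (auto simp: abs_le_iff t_def)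
    qed
    also have "\<dots> = ennreal t * U \<alpha> + ennreal (1 - t) * U \<beta>"
      by (simp add: nn_integral_add nn_integral_cmult scaled_potential_def)
    also have "\<dots> \<le> ennreal t * ennreal v + ennreal (1 - t) * ennreal v"
      by (intro add_mono mult_left_mono U_F \<alpha> \<beta>) auto
    also have "\<dots> = ennreal v"
      using l by (simp flip: distrib_right ennreal_plus)
    finally show ?thesis .
  qed
qed

end

section \<open>Point measures, their limits, and small monic polynomials\<close>

definition empirical_measure :: "(nat \<Rightarrow> real) \<Rightarrow> nat \<Rightarrow> real measure" where
  "empirical_measure x N = distr (measure_pmf (pmf_of_set {..<N})) borel x"

lemma real_distribution_empirical [simp]: "real_distribution (empirical_measure x N)"
  unfolding empirical_measure_def by (rule prob_space.real_distribution_distr[OF prob_space_measure_pmf]) simp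

lemma sets_empirical [simp, measurable_cong]: "sets (empirical_measure x N) = sets borel"
  by (simp add: empirical_measure_def)

lemma nn_integral_empirical:
  assumes "0 < N" and [measurable]: "f \<in> borel_measurable borel"
  shows "(\<integral>\<^sup>+ y. f y \<partial>empirical_measure x N) = (\<Sum>i<N. f (x i)) / of_nat N"
  using assms(1) unfolding empirical_measure_def
  by (subst nn_integral_distr) (auto simp: nn_integral_pmf_of_set lessThan_empty_iff)

lemma AE_empirical:
  assumes "0 < N" and "\<And>i. x i \<in> A" and [measurable]: "A \<in> sets borel"
  shows "AE y in empirical_measure x N. y \<in> A"
  using assms(2) unfolding empirical_measure_def by (subst AE_distr_iff) auto

text \<open>Induction step for a pair sum: the new index meets every earlier one twice, once in each
  order.\<close>

lemma sum_offdiag_Suc: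
  fixes k :: "nat \<Rightarrow> nat \<Rightarrow> real"
  assumes "\<And>i j. k i j = k j i"
  shows "(\<Sum>i<Suc N. \<Sum>j<Suc N. if i = j then 0 else k i j)
    = (\<Sum>i<N. \<Sum>j<N. if i = j then 0 else k i j) + 2 * (\<Sum>i<N. k N i)"
proof -
  have "(\<Sum>i<N. if i = N then 0 else k i N) = (\<Sum>i<N. k N i)"
    "(\<Sum>i<N. if N = i then 0 else k N i) = (\<Sum>i<N. k N i)"
    by (auto intro!: sum.cong simp: assms)
  then show ?thesis by (simp add: sum.distrib)
qed

text \<open>
  Truncating the kernel at distance \<open>1 / N\<close> makes the diagonal terms of the energy negligible.
\<close>
lemma truncated_energy_empirical:
  fixes x :: "nat \<Rightarrow> real"
  assumes N: "0 < N" and R: "0 < R" and inj: "inj x" and dist: "\<And>i j. \<bar>x i - x j\<bar> \<le> R"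
    and sums: "\<And>n. (\<Sum>i<n. ln R - ln \<bar>x n - x i\<bar>) \<le> real n * \<kappa>"
  shows "(\<integral>\<^sup>+ s. \<integral>\<^sup>+ t. logdist R (max \<bar>s - t\<bar> (1 / real N)) \<partial>empirical_measure x N \<partial>empirical_measure x N)
    \<le> ennreal ((\<bar>ln R + ln (real N)\<bar> + (real N - 1) * \<kappa>) / real N)"
proof -
  define k where "k i j = ln R - ln \<bar>x i - x j\<bar>" for i j
  \<comment> \<open>On the diagonal the truncated kernel is \<open>logdist R (1 / real N)\<close>,
    that is \<open>ln R + ln (real N)\<close>; the absolute value makes the bound
    nonnegative.\<close>
  define D where "D i j = (if i = j then \<bar>ln R + ln (real N)\<bar> else k i j)" for i j
  have nz: "x i \<noteq> x j" if "i \<noteq> j" for i j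
    using inj that by (auto dest: injD)
  have k_nonneg: "0 \<le> k i j" if "i \<noteq> j" for i j
    using nz[OF that] dist[of i j] by (simp add: k_def)
  have D_nonneg: "0 \<le> D i j" for i j by (simp add: D_def k_nonneg)
  \<comment> \<open>Adding the \<open>n\<close>-th point costs at most
    \<open>2 * n * \<kappa>\<close>, and these costs add up to
    \<open>n * (n - 1) * \<kappa>\<close>.\<close>
  have offdiag: "(\<Sum>i<n. \<Sum>j<n. if i = j then 0 else k i j) \<le> real n * (real n - 1) * \<kappa>" for n
  proof (induction n)
    case (Suc n)
    have "(\<Sum>i<n. k n i) \<le> real n * \<kappa>" unfolding k_def by (rule sums)
    with Suc show ?case
      by (subst sum_offdiag_Suc) (auto simp: k_def abs_minus_commute algebra_simps)
  qed simp
  have "(\<Sum>i<N. \<Sum>j<N. D i j)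
      = (\<Sum>i<N. \<Sum>j<N. (if i = j then \<bar>ln R + ln (real N)\<bar> else 0) + (if i = j then 0 else k i j))"
    unfolding D_def by (intro sum.cong) auto
  also have "\<dots> = real N * \<bar>ln R + ln (real N)\<bar> + (\<Sum>i<N. \<Sum>j<N. if i = j then 0 else k i j)"
    by (simp add: sum.distrib)
  also have "\<dots> \<le> real N * \<bar>ln R + ln (real N)\<bar> + real N * (real N - 1) * \<kappa>"
    using offdiag[of N] by simp
  finally have sumD: "(\<Sum>i<N. \<Sum>j<N. D i j) \<le> real N * (\<bar>ln R + ln (real N)\<bar> + (real N - 1) * \<kappa>)"
    by (simp add: algebra_simps)
  have le_D: "logdist R (max \<bar>x i - x j\<bar> (1 / real N)) \<le> ennreal (D i j)" for i j
  proof (cases "i = j")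
    case True
    then show ?thesis
      using N by (auto simp: logdist_def D_def ln_div intro!: ennreal_leI)
  next
    case False
    have "logdist R (max \<bar>x i - x j\<bar> (1 / real N)) \<le> logdist R \<bar>x i - x j\<bar>"
      by (intro logdist_antimono) auto
    also have "\<dots> = ennreal (D i j)"
      using False nz[OF False] by (simp add: logdist_def D_def k_def)
    finally show ?thesis .
  qed
  have "(\<integral>\<^sup>+ s. \<integral>\<^sup>+ t. logdist R (max \<bar>s - t\<bar> (1 / real N)) \<partial>empirical_measure x N \<partial>empirical_measure x N)
      = (\<Sum>i<N. (\<Sum>j<N. logdist R (max \<bar>x i - x j\<bar> (1 / real N))) / of_nat N) / of_nat N"
    using N by (simp add: nn_integral_empirical)
  also have "\<dots> \<le> (\<Sum>i<N. (\<Sum>j<N. ennreal (D i j)) / of_nat N) / of_nat N"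
    by (intro divide_right_mono_ennreal sum_mono le_D)
  also have "\<dots> = ennreal ((\<Sum>i<N. (\<Sum>j<N. D i j) / real N) / real N)"
    using N D_nonneg
    by (simp add: ennreal_of_nat_eq_real_of_nat divide_ennreal sum_nonneg)
  also have "\<dots> \<le> ennreal ((\<bar>ln R + ln (real N)\<bar> + (real N - 1) * \<kappa>) / real N)"
  proof (intro ennreal_leI divide_right_mono)
    have "(\<Sum>i<N. (\<Sum>j<N. D i j) / real N) = (\<Sum>i<N. \<Sum>j<N. D i j) / real N"
      by (simp add: sum_divide_distrib)
    also have "\<dots> \<le> \<bar>ln R + ln (real N)\<bar> + (real N - 1) * \<kappa>"
      using sumD N by (simp add: divide_le_eq mult.commute)
    finally show "(\<Sum>i<N. (\<Sum>j<N. D i j) / real N) \<le> \<dots>" .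
  qed simp
  finally show ?thesis .
qed

context equilibrium
begin

lemma E_nonempty: "E \<noteq> {}"
  using rho by (auto simp: prob_on_def)

lemma dist_E: "x \<in> E \<Longrightarrow> y \<in> E \<Longrightarrow> \<bar>x - y\<bar> \<le> R"
  using subsetD[OF E_sub, of x] subsetD[OF E_sub, of y] R by (auto simp: abs_le_iff)

lemma tight_empirical:
  assumes "\<And>i. x i \<in> E"
  shows "tight (\<lambda>n. empirical_measure x (Suc n))"
  unfolding tight_def
proof (intro conjI allI impI)
  fix \<epsilon> :: real assume "0 < \<epsilon>"
  \<comment> \<open>The shift to \<open>a - 1\<close> is due to the interval being open on the left:
    the point \<open>a\<close> may belong to \<open>E\<close>.\<close>
  have "measure (empirical_measure x (Suc n)) {a - 1<..b} = 1" for n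
  proof -
    interpret em: real_distribution "empirical_measure x (Suc n)" by simp
    have "AE y in empirical_measure x (Suc n). y \<in> {a - 1<..b}"
    proof (intro AE_empirical)
      show "x i \<in> {a - 1<..b}" for i using subsetD[OF E_sub assms[of i]] by auto
    qed auto
    then show ?thesis by (subst em.prob_eq_1) auto
  qed
  moreover have "a - 1 < b" using E_nonempty E_sub by fastforce
  ultimately show "\<exists>a b. a < b \<and> (\<forall>n. 1 - \<epsilon> < measure (empirical_measure x (Suc n)) {a<..b})"
    using \<open>0 < \<epsilon>\<close> by (intro exI[of _ "a - 1"] exI[of _ b]) auto
qed simp

text \<open>Tightness gives a weakly convergent subsequence. The truncated energies of the empirical
  measures tend to at most \<open>\<kappa>\<close>, and the truncation disappears in the limit, so
  Fatou's lemma bounds the energy of the limit measure.\<close>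

lemma energy_limit:
  fixes x :: "nat \<Rightarrow> real"
  assumes x_E: "\<And>n. x n \<in> E" and inj: "inj x"
    and sums: "\<And>n. (\<Sum>i<n. ln R - ln \<bar>x n - x i\<bar>) \<le> real n * \<kappa>"
  shows "\<exists>\<nu> \<in> prob_on E. scaled_energy R \<nu> \<le> ennreal \<kappa>"
proof -
  let ?\<nu> = "\<lambda>n. empirical_measure x (Suc n)"
  obtain r M where r: "strict_mono (r :: nat \<Rightarrow> nat)" and M: "real_distribution M"
    and conv: "weak_conv_m (?\<nu> \<circ> id \<circ> r) M"
    using tight_imp_convergent_subsubsequence[OF tight_empirical[of x, OF x_E] strict_mono_id] by auto
  interpret M: real_distribution M by (rule M)
  have "real_distribution ((?\<nu> \<circ> id \<circ> r) n)" for n by simp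
  \<comment> \<open>Skorohod's representation turns weak convergence into pointwise convergence on
    one space, which makes Fatou's lemma applicable to the double integral.\<close>
  from Skorohod[OF this M conv] obtain \<Omega> :: "real measure" and Y_seq Y where "prob_space \<Omega>"
    and "\<forall>n. Y_seq n \<in> measurable \<Omega> borel"
    and "\<forall>n. distr \<Omega> borel (Y_seq n) = (?\<nu> \<circ> id \<circ> r) n"
    and Y: "Y \<in> measurable \<Omega> lborel" and distr_Y: "distr \<Omega> borel Y = M"
    and Y_lim: "\<forall>s\<in>space \<Omega>. (\<lambda>n. Y_seq n s) \<longlonglongrightarrow> Y s"
    by blast
  then have Yn [measurable]: "Y_seq n \<in> measurable \<Omega> borel"
    and distr_Yn: "distr \<Omega> borel (Y_seq n) = ?\<nu> (r n)" for n by auto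
  interpret \<Omega>: prob_space \<Omega> by fact
  have [measurable]: "Y \<in> measurable \<Omega> borel" using Y by simp
  have "AE s in \<Omega>. Y_seq n s \<in> E" for n
  proof -
    have "AE y in distr \<Omega> borel (Y_seq n). y \<in> E"
      unfolding distr_Yn using x_E by (intro AE_empirical) auto
    then show ?thesis by (subst (asm) AE_distr_iff) auto
  qed
  then have "AE s in \<Omega>. \<forall>n. Y_seq n s \<in> E" by (simp add: AE_all_countable)
  then have "AE s in \<Omega>. Y s \<in> E"
    using AE_space
    by eventually_elim (use closed_E Y_lim in \<open>auto simp: closed_sequential_limits\<close>)
  then have "AE y in M. y \<in> E"
    unfolding distr_Y[symmetric] by (subst AE_distr_iff) auto
  then have "emeasure M (UNIV - E) = 0"
    by (subst (asm) AE_iff_measurable[of "UNIV - E"]) auto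
  moreover have "emeasure M UNIV = 1" using M.emeasure_space_1 by simp
  ultimately have "M \<in> prob_on E" by (simp add: prob_on_def)
  define e where "e N = (\<bar>ln R + ln (real N)\<bar> + (real N - 1) * \<kappa>) / real N" for N :: nat
  have "(\<lambda>N. (\<bar>ln R + ln (real N)\<bar>) / real N + \<kappa> - \<kappa> / real N) \<longlonglongrightarrow> 0 + \<kappa> - 0"
  proof (intro tendsto_add tendsto_diff tendsto_const)
    have "(\<lambda>N. ln R / real N + ln (real N) / real N) \<longlonglongrightarrow> 0 + 0"
      by (intro tendsto_add lim_ln_over_n tendsto_divide_0[OF tendsto_const] filterlim_real_sequentially[THEN filterlim_at_top_imp_at_infinity])
    then have "(\<lambda>N. \<bar>ln R / real N + ln (real N) / real N\<bar>) \<longlonglongrightarrow> 0"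
      by (intro tendsto_rabs_zero) simp
    then show "(\<lambda>N. \<bar>ln R + ln (real N)\<bar> / real N) \<longlonglongrightarrow> 0"
      by (simp add: add_divide_distrib[symmetric])
    show "(\<lambda>N. \<kappa> / real N) \<longlonglongrightarrow> 0" by (rule lim_const_over_n)
  qed
  then have "(\<lambda>N. (\<bar>ln R + ln (real N)\<bar>) / real N + \<kappa> - \<kappa> / real N) \<longlonglongrightarrow> \<kappa>" by simp
  moreover have "\<forall>\<^sub>F N in sequentially. (\<bar>ln R + ln (real N)\<bar>) / real N + \<kappa> - \<kappa> / real N = e N"
    using eventually_gt_at_top[of "0::nat"] by eventually_elim (simp add: e_def field_simps)
  ultimately have "e \<longlonglongrightarrow> \<kappa>" by (rule Lim_transform_eventually)
  moreover have Suc_r: "strict_mono (\<lambda>n. Suc (r n))" using r by (simp add: strict_mono_def)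
  ultimately have e_lim: "(\<lambda>n. e (Suc (r n))) \<longlonglongrightarrow> \<kappa>"
    by (auto dest: LIMSEQ_subseq_LIMSEQ simp: comp_def)
  have delta: "(\<lambda>n. 1 / real (Suc (r n))) \<longlonglongrightarrow> 0"
    using LIMSEQ_subseq_LIMSEQ[OF lim_1_over_n Suc_r] by (simp add: comp_def)
  let ?k = "\<lambda>n s t. logdist R (max \<bar>s - t\<bar> (1 / real (Suc (r n))))"
  have "scaled_energy R M = (\<integral>\<^sup>+ s. \<integral>\<^sup>+ t. logdist R \<bar>Y s - Y t\<bar> \<partial>\<Omega> \<partial>\<Omega>)"
    unfolding scaled_energy_def distr_Y[symmetric] by (simp add: nn_integral_distr)
  also have "\<dots> = (\<integral>\<^sup>+ s. \<integral>\<^sup>+ t. liminf (\<lambda>n. ?k n (Y_seq n s) (Y_seq n t)) \<partial>\<Omega> \<partial>\<Omega>)"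
  proof (intro nn_integral_cong lim_imp_Liminf[symmetric])
    fix s t assume st: "s \<in> space \<Omega>" "t \<in> space \<Omega>"
    have "(\<lambda>n. ?k n (Y_seq n s) (Y_seq n t)) \<longlonglongrightarrow> logdist R (max \<bar>Y s - Y t\<bar> 0)"
      using st by (intro tendsto_logdist tendsto_max tendsto_intros bspec[OF Y_lim] delta) auto
    then show "(\<lambda>n. ?k n (Y_seq n s) (Y_seq n t)) \<longlonglongrightarrow> logdist R \<bar>Y s - Y t\<bar>" by simp
  qed simp
  \<comment> \<open>Fatou's lemma, first in the inner and then in the outer integral.\<close>
  also have "\<dots> \<le> (\<integral>\<^sup>+ s. liminf (\<lambda>n. \<integral>\<^sup>+ t. ?k n (Y_seq n s) (Y_seq n t) \<partial>\<Omega>) \<partial>\<Omega>)"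
    by (intro nn_integral_mono nn_integral_liminf) measurable
  also have "\<dots> \<le> liminf (\<lambda>n. \<integral>\<^sup>+ s. \<integral>\<^sup>+ t. ?k n (Y_seq n s) (Y_seq n t) \<partial>\<Omega> \<partial>\<Omega>)"
    by (intro nn_integral_liminf) measurable
  also have "\<dots> = liminf (\<lambda>n. \<integral>\<^sup>+ s. \<integral>\<^sup>+ t. ?k n s t \<partial>?\<nu> (r n) \<partial>?\<nu> (r n))"
    unfolding distr_Yn[symmetric] by (simp add: nn_integral_distr)
  also have "\<dots> \<le> liminf (\<lambda>n. ennreal (e (Suc (r n))))"
    unfolding e_def
    by (intro Liminf_mono always_eventually allI truncated_energy_empirical inj sums dist_E x_E R) simp
  also have "\<dots> = ennreal \<kappa>"
    by (intro lim_imp_Liminf tendsto_ennrealI e_lim) simp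
  finally show ?thesis using \<open>M \<in> prob_on E\<close> by blast
qed

text \<open>
  Otherwise the empirical measures of points \<open>x n\<close> chosen successively so that the polynomial with roots
  \<open>x 0, \<dots>, x (n - 1)\<close> is at least \<open>B ^ n\<close> at \<open>x n\<close> (as for Leja points) would
  converge along a subsequence to a measure on \<open>E\<close> of energy below the minimum.
\<close>
lemma small_monic_poly:
  assumes B: "R * exp (- v) < B"
  shows "\<exists>T :: real poly. lead_coeff T = 1 \<and> 0 < degree T \<and> (\<forall>x\<in>E. \<bar>poly T x\<bar> < B ^ degree T)"
proof (rule ccontr)
  assume "\<not> ?thesis"
  then have large: "\<exists>x\<in>E. B ^ degree T \<le> \<bar>poly T x\<bar>" if "lead_coeff T = 1" "0 < degree T" for T
    using that by (meson not_le)
  have "0 < B" using B R by (meson exp_gt_zero less_trans mult_pos_pos)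
  let ?P = "\<lambda>f n r. r \<in> E \<and> B ^ n \<le> (\<Prod>i<n. \<bar>r - f i\<bar>)"
  have "\<exists>f. \<forall>n. ?P f n (f n)"
  proof (rule dependent_wellorder_choice)
    fix n and f :: "nat \<Rightarrow> real"
    let ?T = "\<Prod>i<n. [:- f i, 1:]"
    have monic: "lead_coeff ?T = 1" by (simp add: lead_coeff_prod)
    have deg: "degree ?T = n" by (simp add: degree_prod_eq_sum_degree)
    show "\<exists>r. ?P f n r"
    proof (cases "n = 0")
      \<comment> \<open>The empty product equals \<open>B ^ 0\<close>, so any point of
        \<open>E\<close> can start the sequence; \<open>large\<close> speaks of positive degrees
        only.\<close>
      case True
      then show ?thesis using E_nonempty by auto
    next
      case False
      then obtain r where "r \<in> E" "B ^ n \<le> \<bar>poly ?T r\<bar>"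
        using large[of ?T] monic deg by auto
      then show ?thesis by (auto simp: poly_prod abs_prod)
    qed
  qed auto
  then obtain x where x: "\<And>n. x n \<in> E" "\<And>n. B ^ n \<le> (\<Prod>i<n. \<bar>x n - x i\<bar>)" by blast
  have neq: "x i \<noteq> x n" if "i < n" for i n
  proof
    assume "x i = x n"
    then have "(\<Prod>i<n. \<bar>x n - x i\<bar>) = 0" using that by (intro prod_zero bexI[of _ i]) auto
    with x(2)[of n] zero_less_power[OF \<open>0 < B\<close>, of n] show False by linarith
  qed
  have inj: "inj x" using neq by (intro linorder_injI) auto
  define \<kappa> where "\<kappa> = ln R - ln B"
  have "(\<Sum>i<n. ln R - ln \<bar>x n - x i\<bar>) \<le> real n * \<kappa>" for n
  proof -
    have "real n * ln B = ln (B ^ n)" using \<open>0 < B\<close> by (simp add: ln_realpow)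
    also have "\<dots> \<le> ln (\<Prod>i<n. \<bar>x n - x i\<bar>)"
      using x(2)[of n] \<open>0 < B\<close> by (intro ln_mono) auto
    also have "\<dots> = (\<Sum>i<n. ln \<bar>x n - x i\<bar>)"
      using neq by (intro ln_prod) (auto dest: neq)
    finally show ?thesis by (simp add: \<kappa>_def sum_subtractf algebra_simps)
  qed
  from energy_limit[OF x(1) inj this] obtain \<nu>
    where "\<nu> \<in> prob_on E" "scaled_energy R \<nu> \<le> ennreal \<kappa>" by blast
  then have "ennreal v \<le> ennreal \<kappa>" using minimal order_trans by blast
  \<comment> \<open>This gives \<open>0 \<le> \<kappa>\<close>; for negative \<open>\<kappa>\<close>
    the value \<open>ennreal \<kappa>\<close> would be \<open>0\<close> and the comparison with
    \<open>v\<close> would be lost.\<close>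
  moreover have "B \<le> R" using x(2)[of 1] dist_E[OF x(1) x(1), of 1 0] by simp
  ultimately have "v \<le> \<kappa>" using \<open>0 < B\<close> by (simp add: \<kappa>_def)
  moreover have "ln R - v < ln B"
    using B R \<open>0 < B\<close> by (metis ln_less_cancel_iff ln_mult ln_exp exp_gt_zero mult_pos_pos add_uminus_conv_diff exp_not_eq_zero less_irrefl)
  ultimately show False by (simp add: \<kappa>_def)
qed

end

section \<open>Lower bound for the norms of monic polynomials\<close>

text \<open>The epsilon-delta form of absolute continuity. Counterexamples with
  \<open>M\<close>-measure below \<open>(1 / 2) ^ k\<close> have an \<open>M\<close>-null limsup by
  Borel-Cantelli, yet continuity from above gives this limsup \<open>N\<close>-measure at least
  \<open>\<eta>\<close>.\<close>

lemma absolutely_continuous_measure_ge: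
  assumes fin: "finite_measure M" "finite_measure N" and sets [simp, measurable_cong]: "sets N = sets M"
    and ac: "absolutely_continuous M N" and \<eta>: "0 < \<eta>"
  obtains \<delta> where "0 < \<delta>" "\<And>A. A \<in> sets M \<Longrightarrow> \<eta> \<le> measure N A \<Longrightarrow> \<delta> \<le> measure M A"
proof (rule ccontr)
  interpret M: finite_measure M by fact
  interpret N: finite_measure N by fact
  assume "\<not> thesis"
  then have "\<exists>A\<in>sets M. \<eta> \<le> measure N A \<and> measure M A < (1 / 2) ^ k" for k :: nat
    using that[of "(1 / 2) ^ k"] by (force simp: not_le)
  then obtain A where A [measurable]: "\<And>k. A k \<in> sets M"
    and N_A: "\<And>k. \<eta> \<le> measure N (A k)" and M_A: "\<And>k. measure M (A k) < (1 / 2) ^ k"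
    by metis
  have "summable (\<lambda>k. measure M (A k))"
    by (rule summable_comparison_test'[OF summable_geometric[of "1 / 2"], of 0])
       (use M_A in \<open>auto intro: less_imp_le\<close>)
  then have "limsup A \<in> null_sets M"
    by (intro borel_cantelli_limsup1) (auto simp: M.emeasure_finite less_top[symmetric])
  then have "limsup A \<in> null_sets N"
    using ac by (auto simp: absolutely_continuous_def)
  then have zero: "measure N (\<Inter>n. \<Union>k\<in>{n..}. A k) = 0"
    by (simp add: limsup_INF_SUP measure_eq_0_null_sets)
  have "(\<lambda>n. measure N (\<Union>k\<in>{n..}. A k)) \<longlonglongrightarrow> measure N (\<Inter>n. \<Union>k\<in>{n..}. A k)"
    by (intro N.finite_Lim_measure_decseq) (auto simp: decseq_def intro: order_trans)
  moreover have "\<eta> \<le> measure N (\<Union>k\<in>{n..}. A k)" for n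
    by (rule order_trans[OF N_A[of n]]) (intro N.finite_measure_mono, auto)
  ultimately have "\<eta> \<le> 0" using LIMSEQ_le_const zero by metis
  with \<eta> show False by simp
qed

text \<open>Factor over the complex numbers and replace each root by its real part, clamped to the
  interval. Both operations can only decrease the distance to a point of the interval.\<close>

lemma monic_poly_ge_real_rooted:
  fixes p :: "real poly"
  assumes p: "lead_coeff p = 1" and ab: "a \<le> b"
  obtains c :: "nat \<Rightarrow> real" where "\<And>i. c i \<in> {a..b}"
    "\<And>x. x \<in> {a..b} \<Longrightarrow> (\<Prod>i<degree p. \<bar>x - c i\<bar>) \<le> \<bar>poly p x\<bar>"
proof -
  define q where "q = map_poly complex_of_real p"
  have q: "lead_coeff q = 1" "degree q = degree p"
    using p by (auto simp: q_def degree_map_poly coeff_map_poly)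
  obtain z where z: "(\<Prod>i<degree p. [:- z i, 1:]) = q"
    using complex_poly_decompose'[of q] q by auto
  define c where "c i = max a (min b (Re (z i)))" for i
  have "(\<Prod>i<degree p. \<bar>x - c i\<bar>) \<le> \<bar>poly p x\<bar>" if x: "x \<in> {a..b}" for x
  proof -
    have "(\<Prod>i<degree p. \<bar>x - c i\<bar>) \<le> (\<Prod>i<degree p. norm (complex_of_real x - z i))"
    proof (intro prod_mono conjI)
      fix i
      have "\<bar>x - c i\<bar> \<le> \<bar>Re (complex_of_real x - z i)\<bar>"
        using x ab by (auto simp: c_def max_def min_def)
      also have "\<dots> \<le> norm (complex_of_real x - z i)" by (rule abs_Re_le_cmod)
      finally show "\<bar>x - c i\<bar> \<le> norm (complex_of_real x - z i)" .
    qed simp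
    also have "\<dots> = norm (poly q (complex_of_real x))"
      unfolding z[symmetric] by (simp add: poly_prod prod_norm)
    also have "poly q (complex_of_real x) = complex_of_real (poly p x)"
      unfolding q_def by (induction p) (auto simp: map_poly_pCons)
    finally show ?thesis by simp
  qed
  then show thesis using ab by (intro that[of c]) (auto simp: c_def)
qed

context equilibrium
begin

text \<open>
  On the set in question \<open>\<Sum>i<n. logdist R \<bar>x - c i\<bar>\<close> is at least \<open>n * ln (R / B)\<close>, while its
  integral is at most \<open>n * v\<close>.
\<close>
lemma measure_small_le:
  assumes n: "0 < n" and B: "0 < B" "B < R" and c: "\<And>i. c i \<in> {a..b}"
  shows "measure \<rho> {x \<in> E. (\<Prod>i<n. \<bar>x - c i\<bar>) \<le> B ^ n} \<le> v / (ln R - ln B)"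
proof -
  define \<kappa> where "\<kappa> = ln R - ln B"
  have \<kappa>: "0 < \<kappa>" using B by (simp add: \<kappa>_def)
  define G where "G = {x \<in> E. (\<Prod>i<n. \<bar>x - c i\<bar>) \<le> B ^ n}"
  have [measurable]: "G \<in> sets borel" unfolding G_def by measurable
  have "ennreal (real n * \<kappa>) * indicator G x \<le> (\<Sum>i<n. logdist R \<bar>c i - x\<bar>)" for x
  proof (cases "x \<in> G")
    case True
    then have xE: "x \<in> {a..b}" and le: "(\<Prod>i<n. \<bar>x - c i\<bar>) \<le> B ^ n"
      using E_sub by (auto simp: G_def)
    show ?thesis
    proof (cases "\<exists>i<n. x = c i")
      \<comment> \<open>A root needs separate treatment: the kernel is infinite there, whereas
        \<open>ln 0 = 0\<close> would spoil the logarithmic computation.\<close>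
      case True
      then obtain i where "i < n" "x = c i" by blast
      then have "(\<Sum>i<n. logdist R \<bar>c i - x\<bar>) = \<top>"
        by (auto intro!: bexI[of _ i])
      then show ?thesis by (simp only: top_greatest)
    next
      case False
      then have nz: "0 < \<bar>x - c i\<bar>" if "i < n" for i using that by auto
      have nonneg: "0 \<le> ln R - ln \<bar>x - c i\<bar>" if "i < n" for i
        using nz[OF that] xE c[of i] R by (auto simp: abs_le_iff)
      have "(\<Sum>i<n. ln \<bar>x - c i\<bar>) = ln (\<Prod>i<n. \<bar>x - c i\<bar>)"
        using nz by (subst ln_prod) auto
      also have "\<dots> \<le> ln (B ^ n)"
        using nz le by (intro ln_mono prod_pos) auto
      also have "\<dots> = real n * ln B" using B by (simp add: ln_realpow)
      finally have "real n * \<kappa> \<le> (\<Sum>i<n. ln R - ln \<bar>x - c i\<bar>)"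
        by (simp add: \<kappa>_def sum_subtractf algebra_simps)
      then have "ennreal (real n * \<kappa>) \<le> (\<Sum>i<n. ennreal (ln R - ln \<bar>x - c i\<bar>))"
        using nonneg by (subst sum_ennreal) (auto intro: ennreal_leI)
      also have "\<dots> = (\<Sum>i<n. logdist R \<bar>c i - x\<bar>)"
        using nz by (intro sum.cong) (auto simp: logdist_def abs_minus_commute)
      finally show ?thesis using True by simp
    qed
  qed simp
  then have "(\<integral>\<^sup>+ x. ennreal (real n * \<kappa>) * indicator G x \<partial>\<rho>) \<le> (\<integral>\<^sup>+ x. (\<Sum>i<n. logdist R \<bar>c i - x\<bar>) \<partial>\<rho>)"
    by (rule nn_integral_mono)
  also have "\<dots> = (\<Sum>i<n. U (c i))" by (simp add: nn_integral_sum scaled_potential_def)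
  also have "\<dots> \<le> (\<Sum>i<n. ennreal v)" by (intro sum_mono U_le c)
  also have "\<dots> = ennreal (real n * v)"
    using v by (simp add: ennreal_of_nat_eq_real_of_nat flip: ennreal_mult)
  finally have "ennreal (real n * \<kappa> * measure \<rho> G) \<le> ennreal (real n * v)"
    using \<kappa> by (simp add: nn_integral_cmult emeasure_eq_measure flip: ennreal_mult)
  then have "real n * \<kappa> * measure \<rho> G \<le> real n * v"
    using v by (simp add: ennreal_le_iff)
  then show ?thesis
    using n \<kappa> by (simp add: G_def \<kappa>_def[symmetric] le_divide_eq mult.commute)
qed

text \<open>A Chebyshev estimate on the part of \<open>E\<close> where the real-rooted minorant
  exceeds \<open>B ^ n\<close>. The constant \<open>\<delta>\<close> is fixed before the polynomial,
  hence is uniform in the degree.\<close>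

lemma integral_poly_square_ge:
  assumes sets_\<mu>: "sets \<mu> = sets borel" and fin: "finite_measure \<mu>"
    and ac: "absolutely_continuous \<mu> \<rho>" and B: "0 < B" "B < R * exp (- v)"
  obtains \<delta> where "0 < \<delta>"
    "\<And>p. lead_coeff p = 1 \<Longrightarrow> 0 < degree p \<Longrightarrow> integrable \<mu> (\<lambda>x. (poly p x)\<^sup>2) \<Longrightarrow>
      \<delta> * (B ^ degree p)\<^sup>2 \<le> (\<integral>x. (poly p x)\<^sup>2 \<partial>\<mu>)"
proof -
  interpret \<mu>: finite_measure \<mu> by fact
  note [measurable_cong] = sets_\<mu>
  have "R * exp (- v) \<le> R" using R v by simp
  then have "B < R" using B by simp
  have "ln B < ln (R * exp (- v))" using B R by (subst ln_less_cancel_iff) auto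
  then have \<kappa>: "v < ln R - ln B" using R by (simp add: ln_mult)
  \<comment> \<open>A lower bound for the \<open>\<rho>\<close>-measure left after removing the set
    of \<open>measure_small_le\<close>; it is positive because \<open>B\<close> is below
    \<open>R * exp (- v)\<close>.\<close>
  define \<eta> where "\<eta> = 1 - v / (ln R - ln B)"
  have "0 < \<eta>" using \<kappa> v by (simp add: \<eta>_def)
  then obtain \<delta> where \<delta>: "0 < \<delta>" "\<And>A. A \<in> sets \<mu> \<Longrightarrow> \<eta> \<le> measure \<rho> A \<Longrightarrow> \<delta> \<le> measure \<mu> A"
    using absolutely_continuous_measure_ge[OF fin finite_measure_axioms _ ac] sets_\<mu> by auto
  show thesis
  proof (rule that[OF \<delta>(1)])
    fix p :: "real poly"
    assume p: "lead_coeff p = 1" "0 < degree p" and int: "integrable \<mu> (\<lambda>x. (poly p x)\<^sup>2)"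
    have "a \<le> b" using E_nonempty E_sub by fastforce
    then obtain c where c: "\<And>i. c i \<in> {a..b}"
      and le: "\<And>x. x \<in> {a..b} \<Longrightarrow> (\<Prod>i<degree p. \<bar>x - c i\<bar>) \<le> \<bar>poly p x\<bar>"
      using monic_poly_ge_real_rooted[OF p(1)] by metis
    define n where "n = degree p"
    define G where "G = {x \<in> E. (\<Prod>i<n. \<bar>x - c i\<bar>) \<le> B ^ n}"
    have [measurable]: "G \<in> sets borel" unfolding G_def by measurable
    have "measure \<rho> G \<le> v / (ln R - ln B)"
      unfolding G_def using p by (intro measure_small_le B \<open>B < R\<close> c) (simp add: n_def)
    moreover have "measure \<rho> (E - G) = measure \<rho> E - measure \<rho> G"
      by (intro finite_measure_Diff) (auto simp: G_def)
    moreover have "measure \<rho> E = 1" using AE_rho by (subst prob_eq_1) auto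
    ultimately have "\<eta> \<le> measure \<rho> (E - G)" by (simp add: \<eta>_def)
    then have "\<delta> \<le> measure \<mu> (E - G)" by (intro \<delta>) (simp add: sets_\<mu>)
    then have "\<delta> * (B ^ n)\<^sup>2 \<le> measure \<mu> (E - G) * (B ^ n)\<^sup>2"
      by (intro mult_right_mono) auto
    also have "\<dots> = (\<integral>x. (B ^ n)\<^sup>2 * indicator (E - G) x \<partial>\<mu>)"
      by (simp add: sets_\<mu> sets_eq_imp_space_eq[OF sets_\<mu>] mult.commute)
    also have "\<dots> \<le> (\<integral>x. (poly p x)\<^sup>2 \<partial>\<mu>)"
    proof (rule integral_mono[OF _ int])
      show "integrable \<mu> (\<lambda>x. (B ^ n)\<^sup>2 * indicator (E - G) x)"
        by (intro integrable_mult_right \<mu>.integrable_const_bound[of _ 1]) (auto split: split_indicator)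
      fix x
      show "(B ^ n)\<^sup>2 * indicator (E - G) x \<le> (poly p x)\<^sup>2"
      proof (cases "x \<in> E - G")
        case True
        then have "B ^ n < (\<Prod>i<n. \<bar>x - c i\<bar>)" "x \<in> {a..b}"
          using E_sub by (auto simp: G_def)
        then have "B ^ n \<le> \<bar>poly p x\<bar>" using le[of x] by (simp add: n_def)
        then show ?thesis using True B power_mono[of "B ^ n" "\<bar>poly p x\<bar>" 2] by simp
      qed simp
    qed
    finally show "\<delta> * (B ^ degree p)\<^sup>2 \<le> (\<integral>x. (poly p x)\<^sup>2 \<partial>\<mu>)" by (simp add: n_def)
  qed
qed

end

section \<open>Support of the measure and the upper bound for the norms\<close>

text \<open>By the Lindelof property countably many null balls cover the complement of the
  support.\<close>

lemma AE_msupp: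
  assumes sets_\<mu>: "sets \<mu> = sets borel"
  shows "AE x in \<mu>. x \<in> msupp \<mu>"
proof -
  define \<F> where "\<F> = {ball x e | x e. 0 < e \<and> emeasure \<mu> (ball x e) = 0}"
  have "\<And>S. S \<in> \<F> \<Longrightarrow> open S" by (auto simp: \<F>_def)
  then obtain \<F>' where \<F>': "\<F>' \<subseteq> \<F>" "countable \<F>'" "\<Union>\<F>' = \<Union>\<F>"
    using Lindelof by metis
  have "S \<in> null_sets \<mu>" if "S \<in> \<F>'" for S
    using \<F>'(1) that sets_\<mu> by (auto simp: \<F>_def null_sets_def)
  then have "\<Union>\<F>' \<in> null_sets \<mu>" using \<F>'(2) by (intro null_sets_UN'[of _ "\<lambda>x. x", simplified])
  moreover have "- msupp \<mu> \<subseteq> \<Union>\<F>'"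
  proof
    fix x assume "x \<in> - msupp \<mu>"
    then obtain e where "0 < e" "emeasure \<mu> (ball x e) = 0" by (auto simp: msupp_def)
    then have "ball x e \<in> \<F>" "x \<in> ball x e" by (auto simp: \<F>_def)
    then show "x \<in> \<Union>\<F>'" unfolding \<F>'(3) by blast
  qed
  ultimately show ?thesis by (intro AE_I'[of "\<Union>\<F>'"]) auto
qed

lemma closed_ess_supp:
  assumes "compact (msupp \<mu>)"
  shows "closed (ess_supp \<mu>)"
proof -
  have "ess_supp \<mu> = msupp \<mu> \<inter> {x. x islimpt msupp \<mu>}" by (auto simp: ess_supp_def)
  then show ?thesis using assms by (simp add: closed_Int compact_imp_closed closed_limpts)
qed

lemma AE_msupp_poly_square_le:
  assumes "sets \<mu> = sets borel" "\<And>x. x \<in> msupp \<mu> \<Longrightarrow> \<bar>poly p x\<bar> \<le> M"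
  shows "AE x in \<mu>. (poly p x)\<^sup>2 \<le> M\<^sup>2"
  using AE_msupp[OF assms(1)]
proof eventually_elim
  case (elim x)
  then show ?case using power_mono[OF assms(2), of x 2] by simp
qed

lemma compact_poly_bound:
  assumes "compact (S :: real set)"
  obtains M where "0 < M" "\<And>x. x \<in> S \<Longrightarrow> \<bar>poly p x\<bar> \<le> M"
proof -
  have "bounded (poly p ` S)"
    by (intro compact_imp_bounded compact_continuous_image continuous_intros assms)
  then obtain M where "0 < M" "\<And>y. y \<in> poly p ` S \<Longrightarrow> norm y \<le> M"
    by (auto simp: bounded_pos)
  then show thesis by (intro that[of M]) auto
qed

text \<open>Excludes the default value \<open>0\<close> of the Bochner integral, which would defeat
  the lower bound on the norms.\<close>

lemma integrable_poly_square:
  assumes "sets \<mu> = sets borel" and fin: "finite_measure \<mu>" and "compact (msupp \<mu>)"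
  shows "integrable \<mu> (\<lambda>x. (poly p x)\<^sup>2)"
proof -
  interpret finite_measure \<mu> by fact
  note [measurable_cong] = assms(1)
  have [measurable]: "poly p \<in> borel_measurable borel"
    by (intro borel_measurable_continuous_onI continuous_intros)
  obtain M where "\<And>x. x \<in> msupp \<mu> \<Longrightarrow> \<bar>poly p x\<bar> \<le> M"
    using compact_poly_bound[OF assms(3)] by metis
  from AE_msupp_poly_square_le[OF assms(1) this]
  show ?thesis by (intro integrable_const_bound[of _ "M\<^sup>2"]) auto
qed

lemma integral_poly_square_le:
  assumes sets_\<mu>: "sets \<mu> = sets borel" and fin: "finite_measure \<mu>" and cpt: "compact (msupp \<mu>)"
    and M: "\<And>x. x \<in> msupp \<mu> \<Longrightarrow> \<bar>poly p x\<bar> \<le> M"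
  shows "(\<integral>x. (poly p x)\<^sup>2 \<partial>\<mu>) \<le> M\<^sup>2 * measure \<mu> UNIV"
proof -
  interpret finite_measure \<mu> by fact
  have "(\<integral>x. (poly p x)\<^sup>2 \<partial>\<mu>) \<le> (\<integral>x. M\<^sup>2 \<partial>\<mu>)"
    by (intro integral_mono_AE integrable_poly_square AE_msupp_poly_square_le assms) simp
  then show ?thesis
    using sets_eq_imp_space_eq[OF sets_\<mu>] by (simp add: mult.commute)
qed

text \<open>
  Powers of \<open>T\<close> are small near the essential support; the finitely many remaining points of the
  support are isolated and become additional zeros.
\<close>
lemma monic_polys_le_on_msupp:
  assumes cpt: "compact (msupp \<mu>)" and T: "lead_coeff T = 1" "0 < degree T" and B: "0 < B"
    and small: "\<And>x. x \<in> ess_supp \<mu> \<Longrightarrow> \<bar>poly T x\<bar> < B ^ degree T"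
  obtains D N where "0 < D"
    "\<And>n. N \<le> n \<Longrightarrow> \<exists>p. degree p = n \<and> lead_coeff p = 1 \<and> (\<forall>x\<in>msupp \<mu>. \<bar>poly p x\<bar> \<le> D * B ^ n)"
proof -
  define m where "m = degree T"
  define Z where "Z = msupp \<mu> \<inter> {x. B ^ m \<le> \<bar>poly T x\<bar>}"
  have "closed {x. B ^ m \<le> \<bar>poly T x\<bar>}"
    by (intro closed_Collect_le continuous_intros)
  then have "compact Z" using cpt unfolding Z_def by (intro compact_Int_closed)
  \<comment> \<open>An infinite compact \<open>Z\<close> would have an accumulation point in
    \<open>Z\<close>; this point lies in the essential support, where \<open>T\<close> is
    small.\<close>
  have "finite Z"
  proof (rule ccontr)
    assume "infinite Z"
    then obtain x where "x \<in> Z" "x islimpt Z"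
      using Heine_Borel_imp_Bolzano_Weierstrass[OF \<open>compact Z\<close>] by blast
    then have "x \<in> ess_supp \<mu>"
      using islimpt_subset[of x Z "msupp \<mu>"] by (auto simp: ess_supp_def Z_def)
    then show False using small[of x] \<open>x \<in> Z\<close> by (simp add: Z_def m_def)
  qed
  define q where "q = (\<Prod>z\<in>Z. [:- z, 1:])"
  have q: "lead_coeff q = 1" "degree q = card Z"
    unfolding q_def by (simp only: lead_coeff_prod, simp) (simp add: degree_prod_eq_sum_degree)
  have q0: "poly q x = 0" if "x \<in> Z" for x
    using that \<open>finite Z\<close> by (auto simp: q_def poly_prod intro!: prod_zero)
  obtain M1 where M1: "0 < M1" "\<And>x. x \<in> msupp \<mu> \<Longrightarrow> \<bar>poly q x\<bar> \<le> M1"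
    using compact_poly_bound[OF cpt] by metis
  obtain M2 where M2: "0 < M2" "\<And>x. x \<in> msupp \<mu> \<Longrightarrow> \<bar>poly [:0, 1:] x\<bar> \<le> M2"
    using compact_poly_bound[OF cpt] by metis
  \<comment> \<open>\<open>K\<close> ensures \<open>\<bar>x\<bar> \<le> B * K\<close> on the
    support, and \<open>1 \<le> K\<close> allows \<open>K ^ r\<close> to be replaced by
    \<open>K ^ m\<close>. In \<open>D\<close> the division by \<open>B ^ card Z\<close> compensates
    for \<open>q\<close>, which has degree \<open>card Z\<close> but is bounded only by
    \<open>M1\<close>.\<close>
  define K where "K = max 1 (M2 / B)"
  define D where "D = M1 * K ^ m / B ^ card Z"
  have "1 \<le> K" by (simp add: K_def)
  show thesis
  proof (rule that[of D "card Z"])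
    show "0 < D" using M1 B \<open>1 \<le> K\<close> by (simp add: D_def)
    fix n assume n: "card Z \<le> n"
    \<comment> \<open>Division with remainder: \<open>T ^ k * q\<close> falls short of degree
      \<open>n\<close> by \<open>r < m\<close>, and a power of the variable fills the gap.\<close>
    define k r where "k = (n - card Z) div m" and "r = (n - card Z) mod m"
    have n_eq: "n = m * k + card Z + r" using n by (simp add: k_def r_def)
    have "r < m" using T by (simp add: r_def m_def)
    define p where "p = T ^ k * q * [:0, 1:] ^ r"
    have nz: "T \<noteq> 0" "q \<noteq> 0" using T q by auto
    have "degree p = n"
      using nz q by (simp add: p_def degree_mult_eq degree_power_eq n_eq m_def)
    moreover have "lead_coeff p = 1"
      using T q unfolding p_def by (simp only: lead_coeff_mult lead_coeff_power) simp
    moreover have "\<bar>poly p x\<bar> \<le> D * B ^ n" if x: "x \<in> msupp \<mu>" for x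
    proof (cases "x \<in> Z")
      case True
      then show ?thesis using q0 \<open>0 < D\<close> B by (simp add: p_def)
    next
      case False
      then have "\<bar>poly T x\<bar> \<le> B ^ m" using x by (simp add: Z_def)
      then have T_le: "\<bar>poly T x\<bar> ^ k \<le> (B ^ m) ^ k" by (rule power_mono) simp
      have "\<bar>x\<bar> \<le> B * K" using M2(2)[OF x] B by (auto simp: K_def max_def field_simps)
      then have "\<bar>x\<bar> ^ r \<le> (B * K) ^ r" by (rule power_mono) simp
      also have "\<dots> \<le> B ^ r * K ^ m"
        using B \<open>1 \<le> K\<close> \<open>r < m\<close> by (simp add: power_mult_distrib mult_left_mono power_increasing)
      finally have x_le: "\<bar>x\<bar> ^ r \<le> B ^ r * K ^ m" .
      have "\<bar>poly p x\<bar> = \<bar>poly T x\<bar> ^ k * \<bar>poly q x\<bar> * \<bar>x\<bar> ^ r"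
        by (simp add: p_def abs_mult power_abs)
      also have "\<dots> \<le> (B ^ m) ^ k * M1 * (B ^ r * K ^ m)"
        using B M1(1) by (intro mult_mono T_le M1(2)[OF x] x_le) auto
      also have "\<dots> = D * B ^ n"
        using B by (simp add: D_def n_eq power_add power_mult)
      finally show ?thesis .
    qed
    ultimately show "\<exists>p. degree p = n \<and> lead_coeff p = 1 \<and> (\<forall>x\<in>msupp \<mu>. \<bar>poly p x\<bar> \<le> D * B ^ n)"
      by blast
  qed
qed

section \<open>Convergence of the roots of the extremal norms\<close>

lemma powr_inverse_tendsto:
  assumes "0 < D" "0 < B"
  shows "(\<lambda>n. (D * B ^ n) powr (1 / real n)) \<longlonglongrightarrow> B"
proof -
  have "(\<lambda>n. D powr (1 / real n) * B) \<longlonglongrightarrow> D powr 0 * B"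
    using assms by (intro tendsto_intros lim_1_over_n) auto
  then have "(\<lambda>n. D powr (1 / real n) * B) \<longlonglongrightarrow> B" using assms by simp
  moreover have "\<forall>\<^sub>F n in sequentially. D powr (1 / real n) * B = (D * B ^ n) powr (1 / real n)"
    using eventually_gt_at_top[of "0::nat"]
    by eventually_elim (use assms in \<open>simp add: powr_mult powr_realpow[symmetric] powr_powr\<close>)
  ultimately show ?thesis by (rule Lim_transform_eventually)
qed

lemma monic_OP_norm_le:
  assumes "degree p = n" "lead_coeff p = 1"
  shows "monic_OP_norm \<mu> n \<le> sqrt (\<integral>x. (poly p x)\<^sup>2 \<partial>\<mu>)"
  unfolding monic_OP_norm_def using assms
  by (intro cInf_lower bdd_belowI[of _ 0]) auto

lemma monic_OP_norm_ge:
  assumes "\<And>p. degree p = n \<Longrightarrow> lead_coeff p = 1 \<Longrightarrow> t \<le> sqrt (\<integral>x. (poly p x)\<^sup>2 \<partial>\<mu>)"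
  shows "t \<le> monic_OP_norm \<mu> n"
  unfolding monic_OP_norm_def
proof (rule cInf_greatest)
  have "degree (monom 1 n :: real poly) = n" "lead_coeff (monom 1 n :: real poly) = 1"
    by (simp_all add: degree_monom_eq)
  then show "{sqrt (\<integral>x. (poly p x)\<^sup>2 \<partial>\<mu>) | p :: real poly. degree p = n \<and> lead_coeff p = 1} \<noteq> {}"
    by blast
qed (use assms in auto)

text \<open>Each half chooses a base \<open>B\<close> strictly between \<open>A\<close> and the
  limit, so that the multiplicative constant disappears in the \<open>n\<close>-th root.\<close>

lemma (in equilibrium) monic_OP_norm_root_tendsto:
  assumes sets_\<mu>: "sets \<mu> = sets borel" and fin: "finite_measure \<mu>" and cpt: "compact (msupp \<mu>)"
    and E: "ess_supp \<mu> = E" and ac: "absolutely_continuous \<mu> \<rho>"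
  shows "(\<lambda>n. monic_OP_norm \<mu> n powr (1 / real n)) \<longlonglongrightarrow> R * exp (- v)"
proof (rule order_tendstoI)
  fix A assume A: "A < R * exp (- v)"
  \<comment> \<open>\<open>A\<close> may be negative; \<open>max A 0\<close> keeps \<open>B\<close>
    positive.\<close>
  define B where "B = (max A 0 + R * exp (- v)) / 2"
  have B: "0 < B" "A < B" "B < R * exp (- v)"
    using A R by (auto simp: B_def max_def field_simps add_pos_pos)
  obtain \<delta> where \<delta>: "0 < \<delta>" and ge: "\<And>p. lead_coeff p = 1 \<Longrightarrow> 0 < degree p \<Longrightarrow>
      integrable \<mu> (\<lambda>x. (poly p x)\<^sup>2) \<Longrightarrow> \<delta> * (B ^ degree p)\<^sup>2 \<le> (\<integral>x. (poly p x)\<^sup>2 \<partial>\<mu>)"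
    using integral_poly_square_ge[OF sets_\<mu> fin ac B(1,3)] by metis
  have "(\<lambda>n. (sqrt \<delta> * B ^ n) powr (1 / real n)) \<longlonglongrightarrow> B"
    using \<delta> B by (intro powr_inverse_tendsto) auto
  from order_tendstoD(1)[OF this B(2)] eventually_gt_at_top[of "0::nat"]
  show "\<forall>\<^sub>F n in sequentially. A < monic_OP_norm \<mu> n powr (1 / real n)"
  proof eventually_elim
    case (elim n)
    have "sqrt \<delta> * B ^ n \<le> monic_OP_norm \<mu> n"
    proof (rule monic_OP_norm_ge)
      fix p :: "real poly" assume p: "degree p = n" "lead_coeff p = 1"
      have "sqrt (\<delta> * (B ^ n)\<^sup>2) \<le> sqrt (\<integral>x. (poly p x)\<^sup>2 \<partial>\<mu>)"
        using ge[of p] p elim(2) integrable_poly_square[OF sets_\<mu> fin cpt, of p] by simp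
      then show "sqrt \<delta> * B ^ n \<le> sqrt (\<integral>x. (poly p x)\<^sup>2 \<partial>\<mu>)"
        using B by (simp add: real_sqrt_mult)
    qed
    then have "(sqrt \<delta> * B ^ n) powr (1 / real n) \<le> monic_OP_norm \<mu> n powr (1 / real n)"
      using \<delta> B by (intro powr_mono2) auto
    then show ?case using elim by simp
  qed
next
  fix A assume A: "R * exp (- v) < A"
  define B where "B = (A + R * exp (- v)) / 2"
  have B: "B < A" "R * exp (- v) < B" using A by (auto simp: B_def)
  have "0 < R * exp (- v)" using R by simp
  then have "0 < B" using B by linarith
  obtain T where T: "lead_coeff T = 1" "0 < degree T" "\<And>x. x \<in> E \<Longrightarrow> \<bar>poly T x\<bar> < B ^ degree T"
    using small_monic_poly[OF B(2)] by blast
  obtain D N where D: "0 < D" and small: "\<And>n. N \<le> n \<Longrightarrow>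
      \<exists>p. degree p = n \<and> lead_coeff p = 1 \<and> (\<forall>x\<in>msupp \<mu>. \<bar>poly p x\<bar> \<le> D * B ^ n)"
    using monic_polys_le_on_msupp[OF cpt T(1,2) \<open>0 < B\<close>] T(3) E by metis
  \<comment> \<open>The summand \<open>1\<close> makes \<open>D'\<close> positive whatever the mass
    of \<open>\<mu>\<close>.\<close>
  define D' where "D' = D * sqrt (measure \<mu> UNIV) + 1"
  have "0 < D'" using D by (simp add: D'_def add_nonneg_pos)
  then have "(\<lambda>n. (D' * B ^ n) powr (1 / real n)) \<longlonglongrightarrow> B"
    using \<open>0 < B\<close> by (rule powr_inverse_tendsto)
  from order_tendstoD(2)[OF this B(1)] eventually_ge_at_top[of N]
  show "\<forall>\<^sub>F n in sequentially. monic_OP_norm \<mu> n powr (1 / real n) < A"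
  proof eventually_elim
    case (elim n)
    obtain p where p: "degree p = n" "lead_coeff p = 1" "\<And>x. x \<in> msupp \<mu> \<Longrightarrow> \<bar>poly p x\<bar> \<le> D * B ^ n"
      using small[OF elim(2)] by blast
    have "monic_OP_norm \<mu> n \<le> sqrt (\<integral>x. (poly p x)\<^sup>2 \<partial>\<mu>)"
      by (rule monic_OP_norm_le[OF p(1,2)])
    also have "\<dots> \<le> sqrt ((D * B ^ n)\<^sup>2 * measure \<mu> UNIV)"
      by (intro real_sqrt_le_mono integral_poly_square_le[OF sets_\<mu> fin cpt] p(3))
    also have "\<dots> = D * sqrt (measure \<mu> UNIV) * B ^ n"
      using D \<open>0 < B\<close> by (simp add: real_sqrt_mult)
    also have "\<dots> \<le> D' * B ^ n" using \<open>0 < B\<close> by (simp add: D'_def)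
    \<comment> \<open>\<open>monic_OP_norm_ge\<close> with \<open>t = 0\<close> supplies the
      nonnegativity that monotonicity of \<open>powr\<close> requires.\<close>
    finally have "monic_OP_norm \<mu> n powr (1 / real n) \<le> (D' * B ^ n) powr (1 / real n)"
      by (intro powr_mono2 monic_OP_norm_ge) auto
    then show ?case using elim by simp
  qed
qed

theorem theorem1p10:
  fixes \<mu> \<rho> :: "real measure"
  assumes "sets \<mu> = sets borel"
    and "finite_measure \<mu>"
    and "compact (msupp \<mu>)"
    and "log_capacity (ess_supp \<mu>) > 0"
    and "equilibrium_measure (ess_supp \<mu>) \<rho>"
    and "absolutely_continuous \<mu> \<rho>"
  shows "regular_measure \<mu>"
proof -
  define E where "E = ess_supp \<mu>"
  have "closed E" unfolding E_def using assms(3) by (rule closed_ess_supp)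
  then have E_borel: "E \<in> sets borel" by simp
  have "bounded (msupp \<mu>)" using assms(3) by (rule compact_imp_bounded)
  then obtain a where "\<forall>x\<in>msupp \<mu>. norm x \<le> a" by (auto simp: bounded_iff)
  then have E_sub: "E \<subseteq> {- a..a}" by (auto simp: E_def ess_supp_def abs_le_iff dest!: bspec)
  \<comment> \<open>\<open>2 * a\<close> bounds the diameter of the hull; the maximum with
    \<open>1\<close> meets the requirement of \<open>log_energy_eq\<close>.\<close>
  define R where "R = max 1 (2 * a)"
  have R: "a - - a \<le> R" "1 \<le> R" by (auto simp: R_def)
  have rho: "\<rho> \<in> prob_on E" and min: "log_energy \<rho> = robin_const E"
    using assms(5) by (auto simp: equilibrium_measure_def E_def)
  have energy: "log_energy \<nu> = enn2ereal (scaled_energy R \<nu>) - ereal (ln R)" if "\<nu> \<in> prob_on E" for \<nu>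
    by (rule log_energy_eq[OF that E_borel E_sub R])
  \<comment> \<open>Positive capacity enters here: an infinite Robin constant would give capacity
    \<open>0\<close> by definition. Hence the minimal energy is a real number
    \<open>v\<close>.\<close>
  have "robin_const E \<noteq> \<infinity>" using assms(4) by (auto simp: log_capacity_def E_def)
  then have "scaled_energy R \<rho> \<noteq> \<top>" using min energy[OF rho] by (auto simp: enn2ereal_top top_ereal_def)
  then obtain v where v: "0 \<le> v" "scaled_energy R \<rho> = ennreal v"
    by (cases "scaled_energy R \<rho>") auto
  have robin: "robin_const E = ereal (v - ln R)"
    using min energy[OF rho] v by (simp add: enn2ereal_ennreal)
  have "ennreal v \<le> scaled_energy R \<nu>" if "\<nu> \<in> prob_on E" for \<nu>
  proof -
    have "robin_const E \<le> log_energy \<nu>" unfolding robin_const_def using that by (rule INF_lower)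
    then show ?thesis
      using v(1) robin energy[OF that]
      by (cases "scaled_energy R \<nu>") (auto simp: enn2ereal_ennreal ennreal_leI)
  qed
  then interpret equilibrium E "- a" a R v \<rho>
    using \<open>closed E\<close> E_sub R rho v by unfold_locales auto
  have "log_capacity E = R * exp (- v)"
    using R by (simp add: log_capacity_def robin exp_diff exp_minus field_simps)
  then show ?thesis
    using monic_OP_norm_root_tendsto[OF assms(1-3) _ assms(6)]
    by (simp add: regular_measure_def E_def)
qed

end
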